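(* Let $n$ be an even positive integer and $k$ an integer with $2\leq k\leq \frac{n}{2}-1$, and let $G$ be a connected balanced bipartite graph of order $n$. If $$\rho(G)\geq \rho\bigl(K_{\frac{n}{2},\frac{n}{2}}\backslash E(K_{1,\frac{n}{2}-k+1})\bigr),$$ then $G$ contains $k$ edge-disjoint perfect matchings, unless $G\cong K_{\frac{n}{2},\frac{n}{2}}\backslash E(K_{1,\frac{n}{2}-k+1})$.
   Context: All graphs are finite, simple and undirected. For a graph $G$, $\rho(G)$ denotes the spectral radius, i.e. the largest eigenvalue of its adjacency matrix. A bipartite graph with bipartition $(X,Y)$ is balanced if $|X|=|Y|$. $K_{p,q}$ is the complete bipartite graph with parts of sizes $p$ and $q$. For a subgraph $H$ of $G$, $G\backslash E(H)$ is the graph obtained from $G$ by deleting the edges of $H$ (keeping all vertices); thus $K_{\frac{n}{2},\frac{n}{2}}\backslash E(K_{1,\frac{n}{2}-k+1})$ is obtained from $K_{\frac n2,\frac n2}$ by deleting $\frac n2-k+1$ edges incident with one fixed vertex. *)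

theory Defs
  imports Complex_Main "HOL-Library.Disjoint_Sets" "Jordan_Normal_Form.Spectral_Radius"
begin

record 'a ugraph =
  verts :: "'a set"
  edges :: "'a set set"

definition simple_graph :: "'a ugraph \<Rightarrow> bool" where
  "simple_graph G \<longleftrightarrow> finite (verts G) \<and> (\<forall>e\<in>edges G. e \<subseteq> verts G \<and> card e = 2)"

definition connected_graph :: "'a ugraph \<Rightarrow> bool" where
  "connected_graph G \<longleftrightarrow> verts G \<noteq> {} \<and>
     (\<forall>u\<in>verts G. \<forall>v\<in>verts G. (u, v) \<in> {(x, y). {x, y} \<in> edges G}\<^sup>*)"

definition bipartition :: "'a ugraph \<Rightarrow> 'a set \<Rightarrow> 'a set \<Rightarrow> bool" where
  "bipartition G X Y \<longleftrightarrow> X \<union> Y = verts G \<and> X \<inter> Y = {} \<and>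
     (\<forall>e\<in>edges G. \<exists>x\<in>X. \<exists>y\<in>Y. e = {x, y})"

definition balanced_bipartite :: "'a ugraph \<Rightarrow> bool" where
  "balanced_bipartite G \<longleftrightarrow> (\<exists>X Y. bipartition G X Y \<and> card X = card Y)"

text \<open>
  The rows and columns of the adjacency matrix are ordered by an arbitrarily chosen enumeration
  of the vertices. Another choice conjugates the matrix by a permutation matrix, so the spectrum
  does not depend on it.
\<close>

definition vertex_enum :: "'a ugraph \<Rightarrow> nat \<Rightarrow> 'a" where
  "vertex_enum G = (SOME f. bij_betw f {..<card (verts G)} (verts G))"

definition adjacency_matrix :: "'a ugraph \<Rightarrow> real mat" where
  "adjacency_matrix G = mat (card (verts G)) (card (verts G))
     (\<lambda>(i, j). if {vertex_enum G i, vertex_enum G j} \<in> edges G then 1 else 0)"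

text \<open>
  The largest real eigenvalue; the adjacency matrix is symmetric, so all its eigenvalues are real.
\<close>

definition graph_spectral_radius :: "'a ugraph \<Rightarrow> real" where
  "graph_spectral_radius G = Max (spectrum (adjacency_matrix G))"

definition complete_bipartite :: "nat \<Rightarrow> nat \<Rightarrow> (nat + nat) ugraph" where
  "complete_bipartite p q =
     \<lparr>verts = {..<p} <+> {..<q}, edges = {{Inl i, Inr j} | i j. i < p \<and> j < q}\<rparr>"

text \<open>
  With the concrete vertices above, \<open>complete_bipartite p' q'\<close> is a subgraph of
  \<open>complete_bipartite p q\<close> whenever \<open>p' \<le> p\<close> and \<open>q' \<le> q\<close>.
\<close>

definition delete_edges_of :: "'a ugraph \<Rightarrow> 'a ugraph \<Rightarrow> 'a ugraph" where
  "delete_edges_of G H = \<lparr>verts = verts G, edges = edges G - edges H\<rparr>"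

definition graph_isomorphic :: "'a ugraph \<Rightarrow> 'b ugraph \<Rightarrow> bool" where
  "graph_isomorphic G H \<longleftrightarrow> (\<exists>f. bij_betw f (verts G) (verts H) \<and>
     (\<forall>u\<in>verts G. \<forall>v\<in>verts G. {u, v} \<in> edges G \<longleftrightarrow> {f u, f v} \<in> edges H))"

definition perfect_matching :: "'a ugraph \<Rightarrow> 'a set set \<Rightarrow> bool" where
  "perfect_matching G M \<longleftrightarrow> M \<subseteq> edges G \<and> disjoint M \<and> \<Union>M = verts G"

definition has_edge_disjoint_perfect_matchings :: "'a ugraph \<Rightarrow> nat \<Rightarrow> bool" where
  "has_edge_disjoint_perfect_matchings G k \<longleftrightarrow>
     (\<exists>M :: nat \<Rightarrow> 'a set set.
        (\<forall>i<k. perfect_matching G (M i)) \<and> disjoint_family_on M {..<k})"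

end

theory Submission
  imports Defs "HOL-Analysis.Convex"
begin

text \<open>
  Write \<open>n = 2 m\<close>. By Koenig's edge colouring theorem, \<open>k\<close> edge-disjoint perfect matchings amount
  to a \<open>k\<close>-factor, which exists iff \<open>e(S, T) \<ge> k (|S| + |T| - m)\<close> for all \<open>S \<subseteq> X\<close> and \<open>T \<subseteq> Y\<close>.
  If this fails for some \<open>S \<noteq> X\<close> and \<open>T \<noteq> Y\<close>, then so many edges are missing that
  \<open>e(G) \<le> m (m - 1)\<close>, hence \<open>\<rho>(G)\<^sup>2 \<le> m (m - 1)\<close>, which is less than the squared spectral radius
  of the extremal graph. Otherwise some vertex has degree less than \<open>k\<close>, so \<open>G\<close> is a spanning
  subgraph of the extremal graph, whose Perron vector has an explicit form; it is a strict
  supersolution on \<open>G\<close> unless the two graphs coincide.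
\<close>

section \<open>Factors of bipartite graphs\<close>

lemma card_rel_eq_sum_rows:
  assumes "finite X" "finite Y" "F \<subseteq> X \<times> Y"
  shows "card F = (\<Sum>x\<in>X. card (F `` {x}))"
proof -
  have "F = Sigma X (\<lambda>x. F `` {x})" using assms(3) by auto
  moreover have "finite (F `` {x})" for x
    by (rule finite_subset[OF _ assms(2)]) (use assms(3) in auto)
  ultimately show ?thesis using assms(1) by (metis card_SigmaI)
qed

lemma card_rel_eq_sum_columns:
  assumes "finite X" "finite Y" "F \<subseteq> X \<times> Y"
  shows "card F = (\<Sum>y\<in>Y. card (F\<inverse> `` {y}))"
proof -
  have "card F = card (F\<inverse>)" by simp
  also have "\<dots> = (\<Sum>y\<in>Y. card (F\<inverse> `` {y}))"
    by (rule card_rel_eq_sum_rows) (use assms in auto)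
  finally show ?thesis .
qed

text \<open>A \<open>k\<close>-factor, held as a relation from \<open>X\<close> to \<open>Y\<close>
  so that both degrees are cardinalities of images; for \<open>k = 1\<close> it is the graph of a
  bijection between \<open>X\<close> and \<open>Y\<close>.\<close>

definition biregular :: "'a set \<Rightarrow> 'b set \<Rightarrow> nat \<Rightarrow> ('a \<times> 'b) set \<Rightarrow> bool" where
  "biregular X Y k F \<longleftrightarrow> F \<subseteq> X \<times> Y \<and>
     (\<forall>x\<in>X. card (F `` {x}) = k) \<and> (\<forall>y\<in>Y. card (F\<inverse> `` {y}) = k)"

text \<open>With parts of equal size, this is the max-flow min-cut inequality for the network with
  unit capacities on \<open>F\<close> and capacity \<open>k\<close> on source and sink arcs,
  \<open>S\<close> being on the source side and \<open>T\<close> on the sink side. Integers allow a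
  negative left side.\<close>

definition cut_condition :: "'a set \<Rightarrow> 'b set \<Rightarrow> nat \<Rightarrow> ('a \<times> 'b) set \<Rightarrow> bool" where
  "cut_condition X Y k F \<longleftrightarrow> (\<forall>S T. S \<subseteq> X \<longrightarrow> T \<subseteq> Y \<longrightarrow>
     int k * (int (card S) + int (card T) - int (card X)) \<le> int (card (F \<inter> S \<times> T)))"

text \<open>Submodularity of the edge count: an edge counted on the left lies in one of the
  rectangles on the right, and one counted twice on the left has its ends in
  \<open>S \<inter> S'\<close> and \<open>T \<inter> T'\<close>, hence lies in both.\<close>

lemma card_rectangle_uncross:
  assumes "finite F"
  shows "card (F \<inter> (S \<inter> S') \<times> (T \<union> T')) + card (F \<inter> (S \<union> S') \<times> (T \<inter> T'))
    \<le> card (F \<inter> S \<times> T) + card (F \<inter> S' \<times> T')"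
proof -
  let ?P = "F \<inter> (S \<inter> S') \<times> (T \<union> T')" and ?Q = "F \<inter> (S \<union> S') \<times> (T \<inter> T')"
  let ?A = "F \<inter> S \<times> T" and ?B = "F \<inter> S' \<times> T'"
  have "card ?P + card ?Q = card (?P \<union> ?Q) + card (?P \<inter> ?Q)"
    using assms by (intro card_Un_Int) auto
  also have "\<dots> \<le> card (?A \<union> ?B) + card (?A \<inter> ?B)"
    using assms by (intro add_mono card_mono) auto
  also have "\<dots> = card ?A + card ?B"
    using assms by (intro card_Un_Int[symmetric]) auto
  finally show ?thesis .
qed

text \<open>In a minimal relation satisfying the cut condition every edge lies in a tight pair.
  Uncrossing the tight pairs at a vertex \<open>x\<close> yields a tight pair \<open>(S, T)\<close> with \<open>x \<in> S\<close> and all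
  neighbours of \<open>x\<close> in \<open>T\<close>; comparing it with \<open>(S - {x}, T)\<close> bounds the degree of \<open>x\<close> by \<open>k\<close>.\<close>

lemma cut_condition_imp_biregular_subrelation:
  assumes fin: "finite X" "finite Y" and cards: "card X = card Y"
    and E: "E \<subseteq> X \<times> Y" and cut: "cut_condition X Y k E"
  obtains F where "F \<subseteq> E" "biregular X Y k F"
proof -
  let ?\<F> = "{F. F \<subseteq> E \<and> cut_condition X Y k F}"
  have finE: "finite E" using E fin by (meson finite_SigmaI finite_subset)
  have "finite ?\<F>" using finE by simp
  moreover have "E \<in> ?\<F>" using cut by simp
  ultimately obtain F where F: "F \<in> ?\<F>" and min: "\<And>F'. F' \<in> ?\<F> \<Longrightarrow> F' \<subseteq> F \<Longrightarrow> F = F'"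
    using finite_has_minimal[of ?\<F>] by (metis (no_types, lifting) empty_iff)
  have FE: "F \<subseteq> E" and Fcut: "cut_condition X Y k F" using F by auto
  have FXY: "F \<subseteq> X \<times> Y" using FE E by blast
  have finF: "finite F" using finE FE by (rule finite_subset[rotated])
  define b where "b S T = int k * (int (card S) + int (card T) - int (card X))" for S :: "'a set" and T :: "'b set"
  define e where "e S T = int (card (F \<inter> S \<times> T))" for S T
  have ge: "b S T \<le> e S T" if "S \<subseteq> X" "T \<subseteq> Y" for S T
    using Fcut that by (simp add: cut_condition_def b_def e_def)
  define tight where "tight S T \<longleftrightarrow> S \<subseteq> X \<and> T \<subseteq> Y \<and> e S T = b S T" for S T
  have tight_ex: "\<exists>S T. tight S T \<and> x \<in> S \<and> y \<in> T" if xy: "(x, y) \<in> F" for x y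
  proof -
    have "F - {(x, y)} \<noteq> F" using xy by auto
    then have "\<not> cut_condition X Y k (F - {(x, y)})" using min[of "F - {(x, y)}"] FE by auto
    then obtain S T where ST: "S \<subseteq> X" "T \<subseteq> Y"
      and less: "int (card ((F - {(x, y)}) \<inter> S \<times> T)) < b S T"
      by (auto simp: cut_condition_def b_def not_le)
    have xyST: "(x, y) \<in> S \<times> T"
    proof (rule ccontr)
      assume "(x, y) \<notin> S \<times> T"
      then have "(F - {(x, y)}) \<inter> S \<times> T = F \<inter> S \<times> T" by blast
      then show False using less ge[OF ST] by (simp add: e_def)
    qed
    have "(F - {(x, y)}) \<inter> S \<times> T = F \<inter> S \<times> T - {(x, y)}" by blast
    \<comment> \<open>All values are integers: together with \<open>b S T \<le> e S T\<close> this
      leaves only equality.\<close>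
    then have "e S T - 1 < b S T" using less xyST xy finF
      by (simp add: e_def card_Diff_singleton)
    then show ?thesis using ST ge[OF ST] xyST unfolding tight_def by (intro exI[of _ S] exI[of _ T]) auto
  qed
  have uncross: "tight (S \<inter> S') (T \<union> T')" if t: "tight S T" "tight S' T'" for S T S' T'
  proof -
    have sub: "S \<subseteq> X" "T \<subseteq> Y" "S' \<subseteq> X" "T' \<subseteq> Y" using t by (auto simp: tight_def)
    then have f: "finite S" "finite T" "finite S'" "finite T'" using fin finite_subset by blast+
    have "e (S \<inter> S') (T \<union> T') + e (S \<union> S') (T \<inter> T') \<le> e S T + e S' T'"
      unfolding e_def using card_rectangle_uncross[OF finF, of S S' T T'] by linarith
    moreover have "b (S \<inter> S') (T \<union> T') + b (S \<union> S') (T \<inter> T') = b S T + b S' T'"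
    proof -
      have "int (card S) + int (card S') = int (card (S \<union> S')) + int (card (S \<inter> S'))"
        using card_Un_Int[OF f(1,3)] by linarith
      moreover have "int (card T) + int (card T') = int (card (T \<union> T')) + int (card (T \<inter> T'))"
        using card_Un_Int[OF f(2,4)] by linarith
      ultimately show ?thesis unfolding b_def distrib_left[symmetric]
        by (intro arg_cong[where f = "\<lambda>z. int k * z"]) linarith
    qed
    moreover have "b (S \<inter> S') (T \<union> T') \<le> e (S \<inter> S') (T \<union> T')" "b (S \<union> S') (T \<inter> T') \<le> e (S \<union> S') (T \<inter> T')"
      using sub by (intro ge; blast)+
    ultimately show ?thesis using t sub unfolding tight_def by auto
  qed
  have row: "card (F `` {x}) = k" if x: "x \<in> X" for x
  proof (rule antisym)
    have finN: "finite (F `` {x})" using finF by simp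
    have slice: "F \<inter> {x} \<times> T = Pair x ` (F `` {x} \<inter> T)" for T by auto
    have "b {x} Y = int k" using cards by (simp add: b_def)
    moreover have "e {x} Y = int (card (F `` {x}))"
    proof -
      have "F `` {x} \<inter> Y = F `` {x}" using FXY by auto
      then show ?thesis unfolding e_def slice by (simp add: card_image inj_on_def)
    qed
    ultimately show "k \<le> card (F `` {x})" using ge[of "{x}" Y] x by simp
    show "card (F `` {x}) \<le> k"
    proof (cases "F `` {x} = {}")
      case False
      \<comment> \<open>The tight pairs of single neighbours are merged one at a time; uncrossing
        keeps \<open>x\<close> in the first component and enlarges the second.\<close>
      have "\<exists>S T. tight S T \<and> x \<in> S \<and> N \<subseteq> T" if "finite N" "N \<noteq> {}" "N \<subseteq> F `` {x}" for N
        using that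
      proof (induction N rule: finite_ne_induct)
        case (singleton y)
        then show ?case using tight_ex[of x y] by auto
      next
        case (insert y N)
        then obtain S T where ST: "tight S T" "x \<in> S" "N \<subseteq> T" by auto
        obtain S' T' where ST': "tight S' T'" "x \<in> S'" "y \<in> T'" using tight_ex[of x y] insert.prems by auto
        show ?case using uncross[OF ST(1) ST'(1)] ST ST'
          by (intro exI[of _ "S \<inter> S'"] exI[of _ "T \<union> T'"]) auto
      qed
      then obtain S T where ST: "tight S T" "x \<in> S" "F `` {x} \<subseteq> T" using finN False by blast
      have finS: "finite S" using ST(1) fin finite_subset unfolding tight_def by blast
      have "F \<inter> S \<times> T = (F \<inter> (S - {x}) \<times> T) \<union> Pair x ` (F `` {x})" using ST by auto
      then have "card (F \<inter> S \<times> T) = card (F \<inter> (S - {x}) \<times> T) + card (Pair x ` (F `` {x}))"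
        using finF by (auto intro!: card_Un_disjoint simp del: Un_Int_eq)
      then have "e S T = e (S - {x}) T + int (card (F `` {x}))"
        unfolding e_def by (simp add: card_image inj_on_def)
      moreover have "b (S - {x}) T = b S T - int k"
      proof -
        have eq: "int (card (S - {x})) = int (card S) - 1"
          using finS ST(2) card_Suc_Diff1[of S x] by linarith
        show ?thesis unfolding b_def eq by (simp add: algebra_simps)
      qed
      moreover have "b (S - {x}) T \<le> e (S - {x}) T" using ST(1) by (intro ge) (auto simp: tight_def)
      ultimately show ?thesis using ST(1) unfolding tight_def by linarith
    qed simp
  qed
  have col_ge: "k \<le> card (F\<inverse> `` {y})" if y: "y \<in> Y" for y
  proof -
    have "F \<inter> X \<times> {y} = (\<lambda>x. (x, y)) ` (F\<inverse> `` {y})" using FXY by auto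
    then have "e X {y} = int (card (F\<inverse> `` {y}))"
      unfolding e_def by (simp add: card_image inj_on_def)
    moreover have "b X {y} = int k" by (simp add: b_def)
    ultimately show ?thesis using ge[of X "{y}"] y by simp
  qed
  \<comment> \<open>Counting \<open>F\<close> by rows gives \<open>k\<close> times
    \<open>card X\<close>, which is \<open>k\<close> times \<open>card Y\<close>; hence no column
    can exceed the lower bound \<open>k\<close>.\<close>
  have total: "(\<Sum>y\<in>Y. card (F\<inverse> `` {y})) = (\<Sum>y\<in>Y. k)"
    using card_rel_eq_sum_rows[OF fin FXY] card_rel_eq_sum_columns[OF fin FXY] row cards by simp
  have "card (F\<inverse> `` {y}) = k" if "y \<in> Y" for y
    using sum_mono_inv[OF total[symmetric] col_ge that fin(2)] by simp
  then have "biregular X Y k F" using row FXY by (simp add: biregular_def)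
  then show ?thesis using that FE by blast
qed

text \<open>Of the \<open>k * card S\<close> edges leaving \<open>S\<close>, at most
  \<open>k * (card X - card T)\<close> end outside \<open>T\<close>, so at least \<open>k\<close>
  times the required number lie in \<open>S \<times> T\<close>. This is the Hall-type condition for
  extracting one perfect matching.\<close>

lemma biregular_imp_cut_condition_1:
  assumes fin: "finite X" "finite Y" and cards: "card X = card Y"
    and F: "biregular X Y k F" and k: "k > 0"
  shows "cut_condition X Y 1 F"
  unfolding cut_condition_def
proof (intro allI impI)
  fix S T assume ST: "S \<subseteq> X" "T \<subseteq> Y"
  have FXY: "F \<subseteq> X \<times> Y" using F by (simp add: biregular_def)
  have finF: "finite F" using FXY fin by (meson finite_SigmaI finite_subset)
  have fST: "finite S" "finite T" using ST fin finite_subset by blast+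
  have 1: "card (F \<inter> S \<times> Y) = k * card S"
  proof -
    have "card (F \<inter> S \<times> Y) = (\<Sum>x\<in>S. card ((F \<inter> S \<times> Y) `` {x}))"
      by (rule card_rel_eq_sum_rows[OF fST(1) fin(2)]) auto
    also have "\<dots> = (\<Sum>x\<in>S. k)"
    proof (rule sum.cong)
      fix x assume x: "x \<in> S"
      then have "(F \<inter> S \<times> Y) `` {x} = F `` {x}" using FXY by auto
      then show "card ((F \<inter> S \<times> Y) `` {x}) = k" using F ST x by (auto simp: biregular_def)
    qed simp
    finally show ?thesis by simp
  qed
  have 2: "card (F \<inter> X \<times> (Y - T)) = k * (card X - card T)"
  proof -
    have "card (F \<inter> X \<times> (Y - T)) = (\<Sum>y\<in>Y - T. card ((F \<inter> X \<times> (Y - T))\<inverse> `` {y}))"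
      by (rule card_rel_eq_sum_columns[OF fin(1)]) (use fin in auto)
    also have "\<dots> = (\<Sum>x\<in>Y - T. k)"
    proof (rule sum.cong)
      fix y assume y: "y \<in> Y - T"
      then have "(F \<inter> X \<times> (Y - T))\<inverse> `` {y} = F\<inverse> `` {y}" using FXY by auto
      then show "card ((F \<inter> X \<times> (Y - T))\<inverse> `` {y}) = k" using F y by (auto simp: biregular_def)
    qed simp
    finally show ?thesis using fST ST cards by (simp add: card_Diff_subset)
  qed
  have "card (F \<inter> S \<times> Y) \<le> card (F \<inter> S \<times> T \<union> F \<inter> X \<times> (Y - T))"
    using finF ST by (intro card_mono) auto
  also have "\<dots> \<le> card (F \<inter> S \<times> T) + card (F \<inter> X \<times> (Y - T))" by (rule card_Un_le)
  finally have 3: "k * card S \<le> card (F \<inter> S \<times> T) + k * (card X - card T)" using 1 2 by simp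
  have Tle: "card T \<le> card X" using ST fin cards card_mono by metis
  have "int k * (int (card S) + int (card T) - int (card X)) \<le> int (card (F \<inter> S \<times> T))"
  proof -
    have "int (k * card S) \<le> int (card (F \<inter> S \<times> T) + k * (card X - card T))" using 3 by linarith
    also have "\<dots> = int (card (F \<inter> S \<times> T)) + int k * (int (card X) - int (card T))"
      using Tle by (simp add: of_nat_diff)
    finally show ?thesis by (simp add: algebra_simps)
  qed
  moreover have "z \<le> c" if "int k * z \<le> c" "0 \<le> c" for z c :: int
  proof (cases "z \<le> 0")
    case False
    then have "1 * z \<le> int k * z" using k by (intro mult_right_mono) auto
    then show ?thesis using that(1) by simp
  qed (use that(2) in simp)
  ultimately show "int 1 * (int (card S) + int (card T) - int (card X)) \<le> int (card (F \<inter> S \<times> T))"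
    by simp
qed

text \<open>Peeling off a 1-factor \<open>R\<close> lowers every degree by one, so induction applies
  to \<open>F - R\<close>; the factors found there are disjoint from \<open>R\<close>.\<close>

lemma biregular_decomposition:
  assumes fin: "finite X" "finite Y" and cards: "card X = card Y" and F: "biregular X Y k F"
  shows "\<exists>M. (\<forall>i<k. biregular X Y 1 (M i) \<and> M i \<subseteq> F) \<and> disjoint_family_on M {..<k}"
  using F
proof (induction k arbitrary: F)
  case 0
  then show ?case by (simp add: disjoint_family_on_def)
next
  case (Suc k)
  have FXY: "F \<subseteq> X \<times> Y" using Suc.prems by (simp add: biregular_def)
  have finF: "finite F" using FXY fin by (meson finite_SigmaI finite_subset)
  have "cut_condition X Y 1 F"
    by (rule biregular_imp_cut_condition_1[OF fin cards Suc.prems]) simp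
  then obtain R where R: "R \<subseteq> F" "biregular X Y 1 R"
    using cut_condition_imp_biregular_subrelation[OF fin cards FXY] by blast
  have finR: "finite R" using R finF finite_subset by blast
  have "biregular X Y k (F - R)"
    unfolding biregular_def
  proof (intro conjI ballI)
    show "F - R \<subseteq> X \<times> Y" using FXY by auto
    fix x assume x: "x \<in> X"
    have "(F - R) `` {x} = F `` {x} - R `` {x}" by auto
    moreover have "R `` {x} \<subseteq> F `` {x}" using R by auto
    ultimately show "card ((F - R) `` {x}) = k"
      using finR R(2) Suc.prems x by (simp add: card_Diff_subset biregular_def)
  next
    fix y assume y: "y \<in> Y"
    have "(F - R)\<inverse> `` {y} = F\<inverse> `` {y} - R\<inverse> `` {y}" by auto
    moreover have "R\<inverse> `` {y} \<subseteq> F\<inverse> `` {y}" using R by auto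
    ultimately show "card ((F - R)\<inverse> `` {y}) = k"
      using finR R(2) Suc.prems y by (simp add: card_Diff_subset biregular_def)
  qed
  from Suc.IH[OF this] obtain M where
    M: "\<And>i. i < k \<Longrightarrow> biregular X Y 1 (M i) \<and> M i \<subseteq> F - R" "disjoint_family_on M {..<k}"
    by blast
  show ?case
  proof (intro exI[of _ "M(k := R)"] conjI allI impI)
    fix i assume "i < Suc k"
    then show "biregular X Y 1 ((M(k := R)) i)" "(M(k := R)) i \<subseteq> F"
      using M(1)[of i] R by (auto simp: less_Suc_eq)
  next
    show "disjoint_family_on (M(k := R)) {..<Suc k}"
      using M unfolding disjoint_family_on_def by (auto simp: less_Suc_eq) blast+
  qed
qed

section \<open>From relations to perfect matchings of a graph\<close>

definition bip_rel :: "'a ugraph \<Rightarrow> 'a set \<Rightarrow> 'a set \<Rightarrow> ('a \<times> 'a) set" where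
  "bip_rel G X Y = {(x, y). x \<in> X \<and> y \<in> Y \<and> {x, y} \<in> edges G}"

lemma perfect_matching_of_biregular:
  assumes bip: "bipartition G X Y" and R: "biregular X Y 1 R" "R \<subseteq> bip_rel G X Y"
  shows "perfect_matching G ((\<lambda>(x, y). {x, y}) ` R)"
proof -
  have XY: "X \<union> Y = verts G" "X \<inter> Y = {}" using bip by (auto simp: bipartition_def)
  have RXY: "R \<subseteq> X \<times> Y" using R by (simp add: biregular_def)
  have row: "y = y'" if "(x, y) \<in> R" "(x, y') \<in> R" for x y y'
  proof -
    have "card (R `` {x}) = 1" using R(1) RXY that by (auto simp: biregular_def)
    then obtain z where "R `` {x} = {z}" by (auto simp: card_1_singleton_iff)
    then show ?thesis using that by (metis Image_singleton_iff singletonD)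
  qed
  have col: "x = x'" if "(x, y) \<in> R" "(x', y) \<in> R" for x x' y
  proof -
    have "card (R\<inverse> `` {y}) = 1" using R(1) RXY that by (auto simp: biregular_def)
    then obtain z where "R\<inverse> `` {y} = {z}" by (auto simp: card_1_singleton_iff)
    then show ?thesis using that by (metis Image_singleton_iff converse_iff singletonD)
  qed
  have ex_row: "\<exists>y. (x, y) \<in> R" if "x \<in> X" for x
  proof -
    have "R `` {x} \<noteq> {}" using R(1) that by (force simp: biregular_def)
    then show ?thesis by auto
  qed
  have ex_col: "\<exists>x. (x, y) \<in> R" if "y \<in> Y" for y
  proof -
    have "R\<inverse> `` {y} \<noteq> {}" using R(1) that by (force simp: biregular_def)
    then show ?thesis by auto
  qed
  show ?thesis
    unfolding perfect_matching_def
  proof (intro conjI)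
    show "(\<lambda>(x, y). {x, y}) ` R \<subseteq> edges G" using R(2) by (auto simp: bip_rel_def)
    show "disjoint ((\<lambda>(x, y). {x, y}) ` R)"
      unfolding disjoint_def
    proof (intro ballI impI)
      fix e e' assume e: "e \<in> (\<lambda>(x, y). {x, y}) ` R" "e' \<in> (\<lambda>(x, y). {x, y}) ` R" and ne: "e \<noteq> e'"
      obtain x y where 1: "e = {x, y}" "(x, y) \<in> R" using e by auto
      obtain x' y' where 2: "e' = {x', y'}" "(x', y') \<in> R" using e by auto
      have in': "x \<in> X" "y \<in> Y" "x' \<in> X" "y' \<in> Y" using 1 2 RXY by auto
      then have "x \<noteq> y'" "y \<noteq> x'" using XY by auto
      moreover have "x \<noteq> x'" using ne 1 2 row by auto
      moreover have "y \<noteq> y'" using ne 1 2 col by auto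
      ultimately show "e \<inter> e' = {}" using 1 2 by auto
    qed
    show "\<Union> ((\<lambda>(x, y). {x, y}) ` R) = verts G"
    proof
      show "\<Union> ((\<lambda>(x, y). {x, y}) ` R) \<subseteq> verts G" using RXY XY by auto
      show "verts G \<subseteq> \<Union> ((\<lambda>(x, y). {x, y}) ` R)"
      proof
        fix v assume "v \<in> verts G"
        then have "v \<in> X \<or> v \<in> Y" using XY by auto
        then show "v \<in> \<Union> ((\<lambda>(x, y). {x, y}) ` R)" using ex_row[of v] ex_col[of v] by force
      qed
    qed
  qed
qed

lemma cut_condition_imp_edge_disjoint_perfect_matchings:
  assumes fin: "finite X" "finite Y" and cards: "card X = card Y"
    and bip: "bipartition G X Y" and cut: "cut_condition X Y k (bip_rel G X Y)"
  shows "has_edge_disjoint_perfect_matchings G k"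
proof -
  have sub: "bip_rel G X Y \<subseteq> X \<times> Y" by (auto simp: bip_rel_def)
  obtain F where F: "F \<subseteq> bip_rel G X Y" "biregular X Y k F"
    using cut_condition_imp_biregular_subrelation[OF fin cards sub cut] .
  obtain M where M: "\<And>i. i < k \<Longrightarrow> biregular X Y 1 (M i) \<and> M i \<subseteq> F" and
    dis: "disjoint_family_on M {..<k}"
    using biregular_decomposition[OF fin cards F(2)] by blast
  have XY: "X \<inter> Y = {}" using bip by (auto simp: bipartition_def)
  \<comment> \<open>As \<open>X\<close> and \<open>Y\<close> are disjoint, an edge determines its
    ordered pair, so disjoint relations give disjoint edge sets.\<close>
  have inj: "inj_on (\<lambda>(x, y). {x, y}) (X \<times> Y)" using XY by (fastforce simp: inj_on_def doubleton_eq_iff)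
  have MXY: "M i \<subseteq> X \<times> Y" if "i < k" for i using M[OF that] F sub by blast
  show ?thesis
    unfolding has_edge_disjoint_perfect_matchings_def
  proof (intro exI[of _ "\<lambda>i. (\<lambda>(x, y). {x, y}) ` M i"] conjI allI impI)
    fix i assume "i < k"
    then show "perfect_matching G ((\<lambda>(x, y). {x, y}) ` M i)"
      using M[of i] F perfect_matching_of_biregular[OF bip] by blast
  next
    show "disjoint_family_on (\<lambda>i. (\<lambda>(x, y). {x, y}) ` M i) {..<k}"
      unfolding disjoint_family_on_def
    proof (intro ballI impI)
      fix i j assume ij: "i \<in> {..<k}" "j \<in> {..<k}" "i \<noteq> j"
      then have "M i \<inter> M j = {}" using dis by (auto simp: disjoint_family_on_def)
      then show "(\<lambda>(x, y). {x, y}) ` M i \<inter> (\<lambda>(x, y). {x, y}) ` M j = {}"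
        using inj_on_image_Int[OF inj MXY[of i] MXY[of j]] ij by auto
    qed
  qed
qed

section \<open>Eigenfunctions of graphs\<close>

text \<open>A complex eigenvalue \<open>z\<close> exists; the Hermitian form at its eigenvector is
  \<open>z\<close> times a positive real and equals its own conjugate, so \<open>z\<close> is real.
  Nonemptiness makes the maximum in \<open>graph_spectral_radius\<close> an actual
  eigenvalue.\<close>

lemma real_symmetric_mat_spectrum_nonempty:
  fixes A :: "real mat"
  assumes A: "A \<in> carrier_mat n n" and n: "n > 0"
    and sym: "\<And>i j. i < n \<Longrightarrow> j < n \<Longrightarrow> A $$ (i, j) = A $$ (j, i)"
  shows "spectrum A \<noteq> {}"
proof -
  define C where "C = map_mat complex_of_real A"
  have C: "C \<in> carrier_mat n n" using A by (simp add: C_def)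
  obtain z v where ev: "eigenvector C v z"
    using spectrum_non_empty[OF C n] by (auto simp: spectrum_def eigenvalue_def)
  have v: "v \<in> carrier_vec n" "v \<noteq> 0\<^sub>v n" "C *\<^sub>v v = z \<cdot>\<^sub>v v"
    using ev C by (auto simp: eigenvector_def)
  have eq: "(\<Sum>j<n. complex_of_real (A $$ (i, j)) * v $ j) = z * v $ i" if i: "i < n" for i
  proof -
    have "(C *\<^sub>v v) $ i = (\<Sum>j<n. complex_of_real (A $$ (i, j)) * v $ j)"
      using i v(1) A by (simp add: C_def scalar_prod_def lessThan_atLeast0)
    then show ?thesis using v i by simp
  qed
  define N where "N = (\<Sum>i<n. (cmod (v $ i))\<^sup>2)"
  define Q where "Q = (\<Sum>i<n. \<Sum>j<n. cnj (v $ i) * complex_of_real (A $$ (i, j)) * v $ j)"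
  obtain i0 where i0: "i0 < n" "v $ i0 \<noteq> 0" using v(1,2) by (metis carrier_vecD eq_vecI index_zero_vec)
  have Npos: "N > 0"
    unfolding N_def by (rule sum_pos2[of _ i0]) (use i0 in auto)
  have "Q = (\<Sum>i<n. cnj (v $ i) * (z * v $ i))"
    unfolding Q_def by (simp add: eq[symmetric] sum_distrib_left mult.assoc)
  also have "\<dots> = z * complex_of_real N"
    unfolding N_def of_real_sum sum_distrib_left complex_norm_square
    by (intro sum.cong refl) (simp only: mult_ac)
  finally have Q1: "Q = z * complex_of_real N" .
  have "cnj Q = (\<Sum>i<n. \<Sum>j<n. v $ i * complex_of_real (A $$ (i, j)) * cnj (v $ j))"
    by (simp add: Q_def)
  also have "\<dots> = (\<Sum>j<n. \<Sum>i<n. v $ i * complex_of_real (A $$ (i, j)) * cnj (v $ j))"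
    by (rule sum.swap)
  also have "\<dots> = Q"
    unfolding Q_def by (intro sum.cong refl) (use sym in \<open>simp add: mult_ac\<close>)
  finally have "cnj z * complex_of_real N = z * complex_of_real N" using Q1 by simp
  then have "cnj z = z" using Npos by simp
  then have z: "z = complex_of_real (Re z)" by (simp add: complex_eq_iff)
  \<comment> \<open>To be applied to the real and imaginary parts of \<open>v\<close>: both satisfy
    the real eigenvalue equation, and one of them is nonzero at \<open>i0\<close>.\<close>
  have real_part: "eigenvalue A (Re z)"
    if g: "\<And>i. i < n \<Longrightarrow> (\<Sum>j<n. A $$ (i, j) * g j) = Re z * g i" and "g i0 \<noteq> 0" for g
  proof -
    have "A *\<^sub>v vec n g = Re z \<cdot>\<^sub>v vec n g"
    proof (rule eq_vecI)
      fix i assume "i < dim_vec (Re z \<cdot>\<^sub>v vec n g)"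
      then show "(A *\<^sub>v vec n g) $ i = (Re z \<cdot>\<^sub>v vec n g) $ i"
        using g[of i] A by (simp add: scalar_prod_def lessThan_atLeast0)
    qed (use A in simp)
    moreover have "vec n g \<noteq> 0\<^sub>v n"
    proof
      assume "vec n g = 0\<^sub>v n"
      then have "vec n g $ i0 = 0\<^sub>v n $ i0" by simp
      then show False using i0(1) that(2) by simp
    qed
    ultimately show ?thesis using A by (auto simp: eigenvalue_def eigenvector_def intro!: exI[of _ "vec n g"])
  qed
  have "(\<Sum>j<n. A $$ (i, j) * Re (v $ j)) = Re z * Re (v $ i)" if "i < n" for i
  proof -
    have "Re (\<Sum>j<n. complex_of_real (A $$ (i, j)) * v $ j) = Re (z * v $ i)" using eq[OF that] by simp
    then show ?thesis by (subst (asm) z) simp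
  qed
  moreover have "(\<Sum>j<n. A $$ (i, j) * Im (v $ j)) = Re z * Im (v $ i)" if "i < n" for i
  proof -
    have "Im (\<Sum>j<n. complex_of_real (A $$ (i, j)) * v $ j) = Im (z * v $ i)" using eq[OF that] by simp
    then show ?thesis by (subst (asm) z) simp
  qed
  moreover have "Re (v $ i0) \<noteq> 0 \<or> Im (v $ i0) \<noteq> 0" using i0 by (simp add: complex_eq_iff)
  ultimately have "eigenvalue A (Re z)"
    using real_part[of "\<lambda>j. Re (v $ j)"] real_part[of "\<lambda>j. Im (v $ j)"] by blast
  then show ?thesis by (auto simp: spectrum_def)
qed

section \<open>Spectra through functions on the vertices\<close>

definition nbrs :: "'a ugraph \<Rightarrow> 'a \<Rightarrow> 'a set" where
  "nbrs G u = {v \<in> verts G. {u, v} \<in> edges G}"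

definition graph_eigenfunction :: "'a ugraph \<Rightarrow> real \<Rightarrow> ('a \<Rightarrow> real) \<Rightarrow> bool" where
  "graph_eigenfunction G \<mu> f \<longleftrightarrow>
     (\<exists>u\<in>verts G. f u \<noteq> 0) \<and> (\<forall>u\<in>verts G. sum f (nbrs G u) = \<mu> * f u)"

lemma nbrs_sym: "u \<in> verts G \<Longrightarrow> v \<in> nbrs G u \<Longrightarrow> u \<in> nbrs G v"
  by (simp add: nbrs_def insert_commute)

lemma vertex_enum_bij_betw:
  assumes "finite (verts G)"
  shows "bij_betw (vertex_enum G) {..<card (verts G)} (verts G)"
  unfolding vertex_enum_def lessThan_atLeast0
  using ex_bij_betw_nat_finite[OF assms] by (rule someI_ex)

lemma adjacency_matrix_mult_vec:
  assumes fin: "finite (verts G)" and v: "v \<in> carrier_vec (card (verts G))"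
    and f: "\<And>i. i < card (verts G) \<Longrightarrow> f (vertex_enum G i) = v $ i"
    and i: "i < card (verts G)"
  shows "(adjacency_matrix G *\<^sub>v v) $ i = sum f (nbrs G (vertex_enum G i))"
proof -
  let ?n = "card (verts G)" and ?e = "vertex_enum G"
  have "(adjacency_matrix G *\<^sub>v v) $ i = (\<Sum>j<?n. (if {?e i, ?e j} \<in> edges G then 1 else 0) * v $ j)"
    using i v by (simp add: adjacency_matrix_def scalar_prod_def lessThan_atLeast0)
  also have "\<dots> = (\<Sum>j<?n. (if {?e i, ?e j} \<in> edges G then f (?e j) else 0))"
    by (rule sum.cong) (auto simp: f)
  also have "\<dots> = (\<Sum>w\<in>verts G. (if {?e i, w} \<in> edges G then f w else 0))"
    by (rule sum.reindex_bij_betw[OF vertex_enum_bij_betw[OF fin]])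
  also have "\<dots> = sum f (nbrs G (?e i))"
    unfolding nbrs_def by (rule sum.inter_filter[OF fin, symmetric])
  finally show ?thesis .
qed

text \<open>Reading vectors along the bijection \<open>vertex_enum\<close> turns matrix eigenvectors
  into functions on the vertices and back, which frees later arguments from the arbitrary
  enumeration.\<close>

lemma spectrum_adjacency_matrix:
  assumes fin: "finite (verts G)"
  shows "\<mu> \<in> spectrum (adjacency_matrix G) \<longleftrightarrow> (\<exists>f. graph_eigenfunction G \<mu> f)"
proof -
  let ?n = "card (verts G)" and ?e = "vertex_enum G" and ?A = "adjacency_matrix G"
  note bij = vertex_enum_bij_betw[OF fin]
  have dim: "dim_row ?A = ?n" "dim_col ?A = ?n" by (auto simp: adjacency_matrix_def)
  show ?thesis
  proof
    assume "\<mu> \<in> spectrum ?A"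
    then obtain v where v: "v \<in> carrier_vec ?n" "v \<noteq> 0\<^sub>v ?n" "?A *\<^sub>v v = \<mu> \<cdot>\<^sub>v v"
      by (auto simp: spectrum_def eigenvalue_def eigenvector_def dim)
    define f where "f u = v $ (the_inv_into {..<?n} ?e u)" for u
    have f: "f (?e i) = v $ i" if "i < ?n" for i
      using that bij by (simp add: f_def bij_betw_def the_inv_into_f_f)
    obtain i0 where i0: "i0 < ?n" "v $ i0 \<noteq> 0" using v(1,2) by (metis carrier_vecD eq_vecI index_zero_vec)
    have "?e i0 \<in> verts G" "f (?e i0) \<noteq> 0" using i0 f bij by (auto simp: bij_betw_def)
    moreover have "sum f (nbrs G u) = \<mu> * f u" if u: "u \<in> verts G" for u
    proof -
      obtain i where i: "i < ?n" "u = ?e i" using bij u by (auto simp: bij_betw_def)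
      show ?thesis using adjacency_matrix_mult_vec[OF fin v(1) f i(1)] v i f by simp
    qed
    ultimately show "\<exists>f. graph_eigenfunction G \<mu> f" by (auto simp: graph_eigenfunction_def)
  next
    assume "\<exists>f. graph_eigenfunction G \<mu> f"
    then obtain f u0 where f: "u0 \<in> verts G" "f u0 \<noteq> 0"
      "\<And>u. u \<in> verts G \<Longrightarrow> sum f (nbrs G u) = \<mu> * f u"
      by (auto simp: graph_eigenfunction_def)
    define v where "v = vec ?n (\<lambda>i. f (?e i))"
    have v: "v \<in> carrier_vec ?n" by (simp add: v_def)
    obtain i0 where i0: "i0 < ?n" "u0 = ?e i0" using bij f(1) by (auto simp: bij_betw_def)
    have "v $ i0 \<noteq> 0\<^sub>v ?n $ i0" using f i0 by (simp add: v_def)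
    then have "v \<noteq> 0\<^sub>v ?n" by auto
    moreover have "?A *\<^sub>v v = \<mu> \<cdot>\<^sub>v v"
    proof (rule eq_vecI)
      fix i assume "i < dim_vec (\<mu> \<cdot>\<^sub>v v)"
      then have i: "i < ?n" by (simp add: v_def)
      then have "?e i \<in> verts G" using bij by (auto simp: bij_betw_def)
      then show "(?A *\<^sub>v v) $ i = (\<mu> \<cdot>\<^sub>v v) $ i"
        using adjacency_matrix_mult_vec[OF fin v, of f] i f(3) by (simp add: v_def)
    qed (simp add: dim v_def)
    ultimately show "\<mu> \<in> spectrum ?A"
      using v by (auto simp: spectrum_def eigenvalue_def eigenvector_def dim)
  qed
qed

lemma finite_spectrum_adjacency_matrix: "finite (spectrum (adjacency_matrix G))"
proof -
  have "adjacency_matrix G \<in> carrier_mat (card (verts G)) (card (verts G))"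
    by (simp add: adjacency_matrix_def)
  then show ?thesis using card_finite_spectrum by blast
qed

lemma graph_spectral_radius_ge:
  assumes "finite (verts G)" "graph_eigenfunction G \<mu> f"
  shows "\<mu> \<le> graph_spectral_radius G"
  unfolding graph_spectral_radius_def
  using spectrum_adjacency_matrix[OF assms(1)] assms(2) finite_spectrum_adjacency_matrix
  by (intro Max_ge) auto

lemma graph_spectral_radius_eigenfunction:
  assumes fin: "finite (verts G)" and ne: "verts G \<noteq> {}"
  shows "\<exists>f. graph_eigenfunction G (graph_spectral_radius G) f"
proof -
  have "spectrum (adjacency_matrix G) \<noteq> {}"
  proof (rule real_symmetric_mat_spectrum_nonempty)
    show "adjacency_matrix G \<in> carrier_mat (card (verts G)) (card (verts G))"
      by (simp add: adjacency_matrix_def)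
    show "card (verts G) > 0" using fin ne by (simp add: card_gt_0_iff)
  qed (simp add: adjacency_matrix_def insert_commute)
  then have "graph_spectral_radius G \<in> spectrum (adjacency_matrix G)"
    unfolding graph_spectral_radius_def using finite_spectrum_adjacency_matrix by (rule Max_in[rotated])
  then show ?thesis using spectrum_adjacency_matrix[OF fin] by blast
qed

text \<open>Self-adjointness of the adjacency operator: both sides sum over ordered adjacent pairs,
  and adjacency is symmetric.\<close>

lemma sum_nbrs_swap:
  fixes f g :: "'a \<Rightarrow> real"
  assumes fin: "finite (verts G)"
  shows "(\<Sum>u\<in>verts G. g u * sum f (nbrs G u)) = (\<Sum>u\<in>verts G. f u * sum g (nbrs G u))"
proof -
  have ind: "h u * sum h' (nbrs G u) = (\<Sum>v\<in>verts G. if {u, v} \<in> edges G then h u * h' v else 0)"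
    for h h' :: "'a \<Rightarrow> real" and u
    unfolding nbrs_def sum_distrib_left by (rule sum.inter_filter[OF fin])
  have "(\<Sum>u\<in>verts G. g u * sum f (nbrs G u)) =
      (\<Sum>u\<in>verts G. \<Sum>v\<in>verts G. if {u, v} \<in> edges G then g u * f v else 0)"
    by (intro sum.cong refl ind)
  also have "\<dots> = (\<Sum>v\<in>verts G. \<Sum>u\<in>verts G. if {u, v} \<in> edges G then g u * f v else 0)"
    by (rule sum.swap)
  also have "\<dots> = (\<Sum>v\<in>verts G. \<Sum>u\<in>verts G. if {v, u} \<in> edges G then f v * g u else 0)"
    by (intro sum.cong refl) (simp only: insert_commute mult.commute)
  also have "\<dots> = (\<Sum>v\<in>verts G. f v * sum g (nbrs G v))"
    by (intro sum.cong refl ind[symmetric])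
  finally show ?thesis .
qed

text \<open>A positive strict supersolution \<open>y\<close> plays the role of the Perron vector: pairing the
  absolute value of an eigenfunction with \<open>y\<close> bounds the eigenvalue, and equality would force
  the eigenfunction to vanish at \<open>u0\<close> and then, by connectedness, everywhere.\<close>

lemma eigenvalue_less_of_supersolution:
  fixes f y :: "'a \<Rightarrow> real"
  assumes conn: "connected_graph G" and sg: "simple_graph G"
    and ev: "graph_eigenfunction G r f"
    and pos: "\<And>u. u \<in> verts G \<Longrightarrow> y u > 0"
    and sup: "\<And>u. u \<in> verts G \<Longrightarrow> sum y (nbrs G u) \<le> \<mu> * y u"
    and strict: "u0 \<in> verts G" "sum y (nbrs G u0) < \<mu> * y u0"
  shows "r < \<mu>"
proof -
  have fin: "finite (verts G)" using sg by (simp add: simple_graph_def)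
  define g where "g u = \<bar>f u\<bar>" for u
  have g0: "g u \<ge> 0" for u by (simp add: g_def)
  have sub: "r * g u \<le> sum g (nbrs G u)" if "u \<in> verts G" for u
  proof -
    have "r * g u \<le> \<bar>r * f u\<bar>" by (simp add: g_def abs_mult mult_right_mono)
    also have "\<dots> = \<bar>sum f (nbrs G u)\<bar>" using ev that by (simp add: graph_eigenfunction_def)
    also have "\<dots> \<le> sum g (nbrs G u)" unfolding g_def by (rule sum_abs)
    finally show ?thesis .
  qed
  obtain w where w: "w \<in> verts G" "f w \<noteq> 0" using ev by (auto simp: graph_eigenfunction_def)
  define P where "P = (\<Sum>u\<in>verts G. y u * g u)"
  \<comment> \<open>By symmetry \<open>K\<close> is also the pairing of \<open>g\<close> with the
    neighbour sums of \<open>y\<close>, which puts it between \<open>r * P\<close> and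
    \<open>\<mu> * P\<close>.\<close>
  define K where "K = (\<Sum>u\<in>verts G. y u * sum g (nbrs G u))"
  have "P > 0"
    unfolding P_def
    by (rule sum_pos2[OF fin w(1)]) (use w pos g0 in \<open>auto simp: g_def intro!: mult_nonneg_nonneg less_imp_le[OF pos]\<close>)
  have s1: "0 \<le> y u * (sum g (nbrs G u) - r * g u)" if "u \<in> verts G" for u
    using sub[OF that] pos[OF that] by simp
  have s2: "0 \<le> g u * (\<mu> * y u - sum y (nbrs G u))" if "u \<in> verts G" for u
    using sup[OF that] g0[of u] by simp
  have e1: "(\<Sum>u\<in>verts G. y u * (sum g (nbrs G u) - r * g u)) = K - r * P"
    by (simp add: P_def K_def right_diff_distrib sum_subtractf sum_distrib_left mult_ac)
  have e2: "(\<Sum>u\<in>verts G. g u * (\<mu> * y u - sum y (nbrs G u))) = \<mu> * P - K"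
    unfolding P_def K_def sum_nbrs_swap[OF fin, of y g]
    by (simp add: right_diff_distrib sum_subtractf sum_distrib_left mult_ac)
  have "0 \<le> K - r * P" unfolding e1[symmetric] by (rule sum_nonneg[OF s1])
  then have nn1: "r * P \<le> K" by simp
  have "0 \<le> \<mu> * P - K" unfolding e2[symmetric] by (rule sum_nonneg[OF s2])
  then have nn2: "K \<le> \<mu> * P" by simp
  have "r * P \<le> \<mu> * P" using nn1 nn2 by (rule order_trans)
  then have "r \<le> \<mu>" using \<open>P > 0\<close> by simp
  moreover have "r \<noteq> \<mu>"
  proof
    assume eq: "r = \<mu>"
    \<comment> \<open>Both sums of nonnegative terms vanish, hence so does each term:
      \<open>g\<close> is zero at \<open>u0\<close> and satisfies the eigenvalue equation exactly,
      so its zeros spread to neighbours.\<close>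
    have K: "K - r * P = 0" "\<mu> * P - K = 0" using nn1 nn2 by (simp_all add: eq)
    have z1: "(\<Sum>u\<in>verts G. y u * (sum g (nbrs G u) - r * g u)) = 0"
      using e1 K(1) by (rule trans)
    have z2: "(\<Sum>u\<in>verts G. g u * (\<mu> * y u - sum y (nbrs G u))) = 0"
      using e2 K(2) by (rule trans)
    have "g u0 * (\<mu> * y u0 - sum y (nbrs G u0)) = 0"
      by (rule sum_nonneg_0[OF fin s2 z2 strict(1)])
    then have g_u0: "g u0 = 0" using strict by simp
    have gs: "sum g (nbrs G u) = r * g u" if u: "u \<in> verts G" for u
    proof -
      have "y u * (sum g (nbrs G u) - r * g u) = 0"
        by (rule sum_nonneg_0[OF fin s1 z1 u])
      then show ?thesis using pos[OF u] by simp
    qed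
    have step: "g v = 0" if "u \<in> verts G" "g u = 0" "v \<in> nbrs G u" for u v
    proof -
      have "sum g (nbrs G u) = 0" using gs[OF that(1)] that(2) by simp
      moreover have "finite (nbrs G u)" using fin by (simp add: nbrs_def)
      ultimately show ?thesis using g0 that(3) sum_nonneg_0[of "nbrs G u" g v] by blast
    qed
    have "(u0, w) \<in> {(x, y). {x, y} \<in> edges G}\<^sup>*"
      using conn strict(1) w(1) by (simp add: connected_graph_def)
    then have "w \<in> verts G \<and> g w = 0"
    proof (induction rule: rtrancl_induct)
      case base
      then show ?case using strict g_u0 by simp
    next
      case (step a b)
      then have "{a, b} \<in> edges G" by simp
      then have "b \<in> verts G" using sg by (auto simp: simple_graph_def)
      then have "b \<in> nbrs G a" using \<open>{a, b} \<in> edges G\<close> by (simp add: nbrs_def)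
      then show ?case using step \<open>b \<in> verts G\<close> \<open>\<And>u v. \<lbrakk>u \<in> verts G; g u = 0; v \<in> nbrs G u\<rbrakk> \<Longrightarrow> g v = 0\<close> by blast
    qed
    then show False using w by (simp add: g_def)
  qed
  ultimately show ?thesis by simp
qed

section \<open>Neighbourhoods and the edge bound in bipartite graphs\<close>

lemma bipartition_nbrs:
  assumes "bipartition G X Y"
  shows "x \<in> X \<Longrightarrow> nbrs G x = bip_rel G X Y `` {x}"
    and "y \<in> Y \<Longrightarrow> nbrs G y = (bip_rel G X Y)\<inverse> `` {y}"
proof -
  have XY: "X \<union> Y = verts G" "X \<inter> Y = {}"
    and e: "\<And>u v. {u, v} \<in> edges G \<Longrightarrow> u \<in> X \<and> v \<in> Y \<or> u \<in> Y \<and> v \<in> X"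
    using assms by (auto simp: bipartition_def doubleton_eq_iff dest!: bspec)
  show "nbrs G x = bip_rel G X Y `` {x}" if "x \<in> X"
    using that XY e[of x] by (auto simp: nbrs_def bip_rel_def)
  show "nbrs G y = (bip_rel G X Y)\<inverse> `` {y}" if "y \<in> Y"
    using that XY e[of y] unfolding nbrs_def bip_rel_def insert_commute[of y] by auto
qed

text \<open>Cauchy-Schwarz bounds \<open>r\<^sup>2 * (f u)\<^sup>2\<close> by the degree of
  \<open>u\<close> times the sum of squares over the whole opposite side. Summing over one side
  turns the degrees into the number of edges, each counted once since \<open>bip_rel\<close> orients
  it from \<open>X\<close> to \<open>Y\<close>.\<close>

lemma bipartite_eigenvalue_square_le:
  assumes fin: "finite X" "finite Y" and bip: "bipartition G X Y" and ev: "graph_eigenfunction G r f"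
  shows "r\<^sup>2 \<le> real (card (bip_rel G X Y))"
proof -
  let ?E = "bip_rel G X Y"
  have XY: "X \<union> Y = verts G" "X \<inter> Y = {}" using bip by (auto simp: bipartition_def)
  have E: "?E \<subseteq> X \<times> Y" by (auto simp: bip_rel_def)
  have CS: "r\<^sup>2 * (f u)\<^sup>2 \<le> real (card N) * (\<Sum>v\<in>Z. (f v)\<^sup>2)"
    if "u \<in> verts G" "nbrs G u = N" "N \<subseteq> Z" "finite Z" for u N Z
  proof -
    have "r\<^sup>2 * (f u)\<^sup>2 = (\<Sum>v\<in>N. f v * 1)\<^sup>2"
      using ev that(1) unfolding that(2)[symmetric]
      by (simp add: graph_eigenfunction_def power_mult_distrib)
    also have "\<dots> \<le> (\<Sum>v\<in>N. (f v)\<^sup>2) * (\<Sum>v\<in>N. 1\<^sup>2)" by (rule Cauchy_Schwarz_ineq_sum)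
    also have "\<dots> \<le> (\<Sum>v\<in>Z. (f v)\<^sup>2) * real (card N)"
      using that by (auto intro!: mult_right_mono sum_mono2)
    finally show ?thesis by (simp add: mult.commute)
  qed
  let ?a = "\<Sum>x\<in>X. (f x)\<^sup>2" and ?b = "\<Sum>y\<in>Y. (f y)\<^sup>2" and ?e = "real (card ?E)"
  have "r\<^sup>2 * ?a \<le> (\<Sum>x\<in>X. real (card (?E `` {x})) * ?b)"
    unfolding sum_distrib_left[of "r\<^sup>2" _ X]
    by (intro sum_mono CS) (use XY E fin bipartition_nbrs(1)[OF bip] in auto)
  also have "\<dots> = ?e * ?b" using card_rel_eq_sum_rows[OF fin E] by (simp add: sum_distrib_right)
  finally have 1: "r\<^sup>2 * ?a \<le> ?e * ?b" .
  have "r\<^sup>2 * ?b \<le> (\<Sum>y\<in>Y. real (card (?E\<inverse> `` {y})) * ?a)"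
    unfolding sum_distrib_left[of "r\<^sup>2" _ Y]
    by (intro sum_mono CS) (use XY E fin bipartition_nbrs(2)[OF bip] in auto)
  also have "\<dots> = ?e * ?a" using card_rel_eq_sum_columns[OF fin E] by (simp add: sum_distrib_right)
  finally have 2: "r\<^sup>2 * ?b \<le> ?e * ?a" .
  \<comment> \<open>The sum \<open>?a + ?b\<close> is positive without knowing on which side
    \<open>f\<close> is nonzero.\<close>
  have 3: "r\<^sup>2 * (?a + ?b) \<le> ?e * (?a + ?b)" using 1 2 by (simp add: distrib_left)
  obtain w where w: "w \<in> verts G" "f w \<noteq> 0" using ev by (auto simp: graph_eigenfunction_def)
  have "?a + ?b = (\<Sum>v\<in>verts G. (f v)\<^sup>2)"
    using XY fin by (metis sum.union_disjoint)
  also have "\<dots> > 0" by (rule sum_pos2[of _ w]) (use w fin XY(1)[symmetric] in auto)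
  finally show ?thesis using 3 by simp
qed

section \<open>The extremal graph\<close>

text \<open>Values \<open>a, b, c, d\<close> of the Perron vector of the graph obtained from \<open>K\<^bsub>m,m\<^esub>\<close> by deleting
  \<open>m - q\<close> edges at a vertex \<open>x0\<close>: on \<open>x0\<close>, on the rest of its side, and on the vertices of the
  other side that are nonadjacent, respectively adjacent, to \<open>x0\<close>. Eliminating them leaves
  \<open>(\<mu>\<^sup>2 - m (m - 1)) (\<mu>\<^sup>2 - q) = q\<^sup>2 (m - 1)\<close>.\<close>

lemma perron_weights:
  fixes m q :: real
  assumes q: "1 \<le> q" "q < m" and m: "2 \<le> m"
  obtains \<mu> a b c d where "\<mu> > 0" "a > 0" "b > 0" "c > 0" "d > 0" "m * (m - 1) < \<mu>\<^sup>2"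
    "\<mu> * a = q * d" "\<mu> * b = (m - q) * c + q * d" "\<mu> * c = (m - 1) * b" "\<mu> * d = a + (m - 1) * b"
proof -
  define M where "M = m * (m - 1)"
  \<comment> \<open>\<open>\<theta>\<close> will be the larger root of the quadratic for
    \<open>\<mu>\<^sup>2\<close>, and \<open>D\<close> is the square root of its
    discriminant.\<close>
  define D where "D = sqrt ((M - q)\<^sup>2 + 4 * (q\<^sup>2 * (m - 1)))"
  define \<theta> where "\<theta> = (M + q + D) / 2"
  define \<mu> where "\<mu> = sqrt \<theta>"
  have "m * 1 \<le> M" unfolding M_def using m by (intro mult_left_mono) auto
  then have Mq: "M > q" using q by linarith
  have L: "q\<^sup>2 * (m - 1) > 0" using q m by simp
  have D2: "D\<^sup>2 = (M - q)\<^sup>2 + 4 * (q\<^sup>2 * (m - 1))" unfolding D_def using L by simp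
  have "(M - q)\<^sup>2 < D\<^sup>2" using D2 L by linarith
  then have "M - q < D" by (rule power2_less_imp_less) (use L in \<open>simp add: D_def\<close>)
  then have \<theta>M: "\<theta> > M" by (simp add: \<theta>_def)
  have quad: "(\<theta> - M) * (\<theta> - q) = q\<^sup>2 * (m - 1)"
  proof -
    have "4 * ((\<theta> - M) * (\<theta> - q)) = (D - (M - q)) * (D + (M - q))"
      by (simp add: \<theta>_def field_simps)
    also have "\<dots> = D\<^sup>2 - (M - q)\<^sup>2" by (simp add: power2_eq_square algebra_simps)
    finally show ?thesis using D2 by linarith
  qed
  have \<theta>0: "\<theta> > 0" using \<theta>M Mq q by linarith
  have \<mu>: "\<mu> > 0" "\<mu> * \<mu> = \<theta>" using \<theta>0 by (auto simp: \<mu>_def)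
  \<comment> \<open>Inserting the fourth equation into \<open>\<mu>\<close> times the first gives
    \<open>(\<theta> - q) * a = q * (m - 1) * b\<close>, which fixes \<open>a\<close> and
    \<open>b\<close> up to scaling; \<open>c\<close> and \<open>d\<close> are read off the last two
    equations.\<close>
  define a b where "a = q * (m - 1)" and "b = \<theta> - q"
  define c d where "c = (m - 1) * b / \<mu>" and "d = (a + (m - 1) * b) / \<mu>"
  have pos: "a > 0" "b > 0" using q m \<theta>M Mq by (auto simp: a_def b_def)
  then have pos': "c > 0" "d > 0" using \<mu> m by (auto simp: c_def d_def intro!: divide_pos_pos add_pos_pos)
  have c: "\<mu> * c = (m - 1) * b" and d: "\<mu> * d = a + (m - 1) * b" using \<mu> by (auto simp: c_def d_def)
  have "\<mu> * (\<mu> * a) = \<mu> * (q * d)"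
  proof -
    have "\<mu> * (\<mu> * a) = \<theta> * a" using \<mu>(2) by (metis mult.assoc)
    also have "\<dots> = q * (\<mu> * d)" unfolding d by (simp add: a_def b_def algebra_simps)
    finally show ?thesis by (simp add: mult_ac)
  qed
  then have 1: "\<mu> * a = q * d" using \<mu>(1) by simp
  have "\<mu> * (\<mu> * b) = \<mu> * ((m - q) * c + q * d)"
  proof -
    have "\<mu> * (\<mu> * b) = \<theta> * b" using \<mu>(2) by (metis mult.assoc)
    also have "\<dots> = M * b + q * a"
      using quad by (simp add: a_def b_def power2_eq_square algebra_simps)
    also have "\<dots> = (m - q) * (\<mu> * c) + q * (\<mu> * d)" unfolding c d M_def by (simp add: algebra_simps)
    finally show ?thesis by (simp add: algebra_simps)
  qed
  then have 2: "\<mu> * b = (m - q) * c + q * d" using \<mu>(1) by simp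
  have "m * (m - 1) < \<mu>\<^sup>2" using \<theta>M \<mu>(2) by (simp add: M_def power2_eq_square)
  then show ?thesis using that[of \<mu> a b c d] \<mu>(1) pos pos' 1 2 c d by blast
qed

text \<open>Neighbourhoods in the complete bipartite graph on \<open>X\<close> and \<open>Y\<close>
  minus the star from \<open>x0\<close> to \<open>Z\<close>, meant for \<open>x0 \<in> X\<close>,
  \<open>Z \<subseteq> Y\<close> and \<open>u \<in> X \<union> Y\<close>. In this form it applies to
  an arbitrary graph and to the concrete extremal graph alike.\<close>

definition star_deleted_nbrs :: "'a set \<Rightarrow> 'a set \<Rightarrow> 'a \<Rightarrow> 'a set \<Rightarrow> 'a \<Rightarrow> 'a set" where
  "star_deleted_nbrs X Y x0 Z u =
     (if u = x0 then Y - Z else if u \<in> X then Y else if u \<in> Z then X - {x0} else X)"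

text \<open>With \<open>q = card Y - card Z\<close>, the equations of \<open>perron_weights\<close>
  are the eigenvalue equation at the four classes of vertices on which \<open>w\<close> is
  constant.\<close>

lemma sum_weights_star_deleted_nbrs:
  fixes \<mu> a b c d :: real
  assumes fin: "finite X" "finite Y" and disj: "X \<inter> Y = {}" and x0: "x0 \<in> X" and Z: "Z \<subseteq> Y"
    and \<mu>: "\<mu> * a = (real (card Y) - real (card Z)) * d"
      "\<mu> * b = real (card Z) * c + (real (card Y) - real (card Z)) * d"
      "\<mu> * c = (real (card X) - 1) * b" "\<mu> * d = a + (real (card X) - 1) * b"
    and u: "u \<in> X \<union> Y"
    and w: "w = (\<lambda>u. if u = x0 then a else if u \<in> X then b else if u \<in> Z then c else d)"
  shows "sum w (star_deleted_nbrs X Y x0 Z u) = \<mu> * w u"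
proof -
  have finZ: "finite Z" using Z fin finite_subset by blast
  have "sum w (Y - Z) = (\<Sum>y\<in>Y - Z. d)" by (rule sum.cong) (use x0 disj in \<open>auto simp: w\<close>)
  then have YZ: "sum w (Y - Z) = (real (card Y) - real (card Z)) * d"
    using Z fin finZ by (simp add: card_Diff_subset of_nat_diff card_mono)
  have "sum w Z = (\<Sum>y\<in>Z. c)" by (rule sum.cong) (use x0 Z disj in \<open>auto simp: w\<close>)
  then have WZ: "sum w Z = real (card Z) * c" by simp
  have WY: "sum w Y = real (card Z) * c + (real (card Y) - real (card Z)) * d"
    using sum.subset_diff[OF Z fin(2), of w] YZ WZ by simp
  have "sum w (X - {x0}) = (\<Sum>x\<in>X - {x0}. b)" by (rule sum.cong) (auto simp: w)
  moreover have "card X \<ge> 1" using x0 fin by (metis One_nat_def Suc_leI card_gt_0_iff empty_iff)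
  ultimately have Wx: "sum w (X - {x0}) = (real (card X) - 1) * b"
    using x0 fin by (simp add: of_nat_diff)
  have WX: "sum w X = a + (real (card X) - 1) * b"
    using sum.remove[OF fin(1) x0, of w] Wx by (simp add: w)
  consider "u = x0" | "u \<in> X" "u \<noteq> x0" | "u \<in> Z" "u \<notin> X" | "u \<in> Y" "u \<notin> X" "u \<notin> Z"
    using u by blast
  then show ?thesis
  proof cases
    case 1
    then show ?thesis using YZ \<mu>(1) by (simp add: star_deleted_nbrs_def w)
  next
    case 2
    then show ?thesis using WY \<mu>(2) by (simp add: star_deleted_nbrs_def w)
  next
    case 3
    then have "u \<noteq> x0" using x0 by auto
    then show ?thesis using 3 Wx \<mu>(3) by (simp add: star_deleted_nbrs_def w)
  next
    case 4
    then have "u \<noteq> x0" using x0 by auto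
    then show ?thesis using 4 WX \<mu>(4) by (simp add: star_deleted_nbrs_def w)
  qed
qed

text \<open>The classes \<open>{x0}\<close>, \<open>X - {x0}\<close>, \<open>Z\<close> and
  \<open>Y - Z\<close> match their counterparts in size, and adjacency depends only on the classes
  of the two ends, so bijections between classes glue to an isomorphism.\<close>

lemma star_deleted_graphs_isomorphic:
  assumes fin: "finite X" "finite Y" "finite X'" "finite Y'"
    and G: "verts G = X \<union> Y" "X \<inter> Y = {}" "x0 \<in> X" "Z \<subseteq> Y"
      "\<And>u. u \<in> verts G \<Longrightarrow> nbrs G u = star_deleted_nbrs X Y x0 Z u"
    and H: "verts H = X' \<union> Y'" "X' \<inter> Y' = {}" "x0' \<in> X'" "Z' \<subseteq> Y'"
      "\<And>u. u \<in> verts H \<Longrightarrow> nbrs H u = star_deleted_nbrs X' Y' x0' Z' u"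
    and cards: "card X = card X'" "card Y = card Y'" "card Z = card Z'"
  shows "graph_isomorphic G H"
proof -
  have finZ: "finite Z" "finite Z'" using G(4) H(4) fin finite_subset by blast+
  have "card (X - {x0}) = card (X' - {x0'})" using cards G(3) H(3) fin by simp
  then obtain h where h: "bij_betw h (X - {x0}) (X' - {x0'})"
    using fin by (meson finite_Diff finite_same_card_bij)
  obtain i where i: "bij_betw i Z Z'"
    using cards(3) finZ by (meson finite_same_card_bij)
  have "card (Y - Z) = card (Y' - Z')" using cards G(4) H(4) finZ by (simp add: card_Diff_subset)
  then obtain j where j: "bij_betw j (Y - Z) (Y' - Z')"
    using fin by (meson finite_Diff finite_same_card_bij)
  define f where "f u = (if u = x0 then x0' else if u \<in> X then h u else if u \<in> Z then i u else j u)" for u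
  have disj: "x \<notin> Y" if "x \<in> X" for x using G(2) that by auto
  have disj': "x \<notin> Y'" if "x \<in> X'" for x using H(2) that by auto
  have fx0: "f x0 = x0'" by (simp add: f_def)
  have fh: "bij_betw f (X - {x0}) (X' - {x0'})"
    using h by (rule bij_betw_cong[THEN iffD1, rotated]) (auto simp: f_def)
  have fi: "bij_betw f Z Z'"
    using i by (rule bij_betw_cong[THEN iffD1, rotated]) (use G(3,4) disj in \<open>auto simp: f_def\<close>)
  have fj: "bij_betw f (Y - Z) (Y' - Z')"
    using j by (rule bij_betw_cong[THEN iffD1, rotated]) (use G(3,4) disj in \<open>auto simp: f_def\<close>)
  have "bij_betw f (insert x0 (X - {x0})) (insert x0' (X' - {x0'}))"
    using bij_betw_combine[of f "{x0}" "{x0'}", OF _ fh] fx0 by (simp add: bij_betw_def)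
  then have fX: "bij_betw f X X'" using G(3) H(3) by (simp add: insert_absorb)
  have "bij_betw f (Z \<union> (Y - Z)) (Z' \<union> (Y' - Z'))" by (rule bij_betw_combine[OF fi fj]) auto
  then have fY: "bij_betw f Y Y'" using G(4) H(4) by (simp add: Un_absorb1)
  have fV: "bij_betw f (verts G) (verts H)"
    unfolding G(1) H(1) by (rule bij_betw_combine[OF fX fY H(2)])
  have in_X: "f u \<in> X' \<longleftrightarrow> u \<in> X" and in_Y: "f u \<in> Y' \<longleftrightarrow> u \<in> Y" if "u \<in> verts G" for u
    using that G(1) bij_betwE[OF fX] bij_betwE[OF fY] disj disj' by blast+
  have in_Z: "f u \<in> Z' \<longleftrightarrow> u \<in> Z" if "u \<in> verts G" for u
    using that G(1,4) H(4) bij_betwE[OF fX] bij_betwE[OF fi] bij_betwE[OF fj] disj' by blast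
  have eq_x0: "f u = x0' \<longleftrightarrow> u = x0" if "u \<in> verts G" for u
    using that G(1) bij_betwE[OF fh] bij_betwE[OF fY] fx0 H(3) disj' by blast
  have fin_verts: "f u \<in> verts H" if "u \<in> verts G" for u using bij_betwE[OF fV] that by blast
  have "{u, v} \<in> edges G \<longleftrightarrow> {f u, f v} \<in> edges H" if uv: "u \<in> verts G" "v \<in> verts G" for u v
  proof -
    have "{u, v} \<in> edges G \<longleftrightarrow> v \<in> star_deleted_nbrs X Y x0 Z u"
      using G(5)[OF uv(1)] uv(2) by (auto simp: nbrs_def)
    also have "\<dots> \<longleftrightarrow> f v \<in> star_deleted_nbrs X' Y' x0' Z' (f u)"
      by (simp add: star_deleted_nbrs_def in_X in_Y in_Z eq_x0 uv)
    also have "\<dots> \<longleftrightarrow> {f u, f v} \<in> edges H"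
      using H(5)[OF fin_verts[OF uv(1)]] fin_verts[OF uv(2)] by (auto simp: nbrs_def)
    finally show ?thesis .
  qed
  then show ?thesis unfolding graph_isomorphic_def using fV by blast
qed

text \<open>The left part of \<open>complete_bipartite 1 p\<close> is the single vertex
  \<open>Inl 0\<close>, so the deleted star is centred there, with the first \<open>p\<close> right
  vertices as leaves.\<close>

lemma nbrs_complete_bipartite_minus_star:
  assumes "0 < m" "p \<le> m" and u: "u \<in> verts (complete_bipartite m m)"
  shows "nbrs (delete_edges_of (complete_bipartite m m) (complete_bipartite 1 p)) u =
    star_deleted_nbrs (Inl ` {..<m}) (Inr ` {..<m}) (Inl 0) (Inr ` {..<p}) u"
  using assms
  by (auto simp: nbrs_def delete_edges_of_def complete_bipartite_def star_deleted_nbrs_def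
      doubleton_eq_iff)

text \<open>A vertex of degree at most \<open>k - 1\<close> misses at least \<open>m - k + 1\<close>
  opposite vertices, so \<open>G\<close> sits inside a star-deleted graph with
  \<open>q = k - 1\<close>. The weights of that graph are a supersolution on \<open>G\<close>, with
  equality everywhere only if the graphs agree, which \<open>not_iso\<close> excludes.\<close>

lemma low_degree_spectral_radius_less:
  fixes \<mu> a b c d :: real
  assumes sg: "simple_graph G" and conn: "connected_graph G" and bip: "bipartition G X Y"
    and cards: "card X = m" "card Y = m" and k: "2 \<le> k" "k \<le> m - 1"
    and x0: "x0 \<in> X" "card (nbrs G x0) < k"
    and not_iso: "\<not> graph_isomorphic G
      (delete_edges_of (complete_bipartite m m) (complete_bipartite 1 (m - k + 1)))"
    and pos: "a > 0" "b > 0" "c > 0" "d > 0"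
    and \<mu>: "\<mu> * a = real (k - 1) * d" "\<mu> * b = (real m - real (k - 1)) * c + real (k - 1) * d"
      "\<mu> * c = (real m - 1) * b" "\<mu> * d = a + (real m - 1) * b"
  shows "graph_spectral_radius G < \<mu>"
proof -
  have XY: "verts G = X \<union> Y" "X \<inter> Y = {}" using bip by (auto simp: bipartition_def)
  have finV: "finite (verts G)" using sg by (simp add: simple_graph_def)
  then have fin: "finite X" "finite Y" using XY by auto
  have nbr_X: "nbrs G x \<subseteq> Y" if "x \<in> X" for x
    using bipartition_nbrs(1)[OF bip that] by (auto simp: bip_rel_def)
  have nbr_Y: "nbrs G y \<subseteq> X" if "y \<in> Y" for y
    using bipartition_nbrs(2)[OF bip that] by (auto simp: bip_rel_def)
  have "card (Y - nbrs G x0) = m - card (nbrs G x0)"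
    using nbr_X[OF x0(1)] fin cards by (simp add: card_Diff_subset finite_subset)
  then have "m - k + 1 \<le> card (Y - nbrs G x0)" using x0(2) k by linarith
  then obtain Z where Z: "Z \<subseteq> Y - nbrs G x0" "card Z = m - k + 1"
    using obtain_subset_with_card_n by metis
  have ZY: "Z \<subseteq> Y" using Z by auto
  let ?N = "star_deleted_nbrs X Y x0 Z"
  have sub: "nbrs G u \<subseteq> ?N u" if u: "u \<in> verts G" for u
  proof (cases "u \<in> X")
    case True
    then show ?thesis using nbr_X[OF True] Z by (auto simp: star_deleted_nbrs_def)
  next
    case False
    then have uY: "u \<in> Y" using u XY by auto
    have "x0 \<notin> nbrs G u" if "u \<in> Z" using Z that nbrs_sym[of u G x0] u by auto
    then show ?thesis using nbr_Y[OF uY] False x0 by (auto simp: star_deleted_nbrs_def)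
  qed
  have finN: "finite (?N u)" for u using fin by (simp add: star_deleted_nbrs_def)
  have Nsub: "?N u \<subseteq> verts G" for u using XY by (auto simp: star_deleted_nbrs_def)
  define w where "w = (\<lambda>u. if u = x0 then a else if u \<in> X then b else if u \<in> Z then c else d)"
  have wpos: "w u > 0" for u using pos by (simp add: w_def)
  have cZ: "real (card Z) = real m - real (k - 1)" using Z(2) k by (simp add: of_nat_diff)
  have wN: "sum w (?N u) = \<mu> * w u" if "u \<in> verts G" for u
    by (rule sum_weights_star_deleted_nbrs[OF fin XY(2) x0(1) ZY _ _ _ _ _ w_def])
      (use \<mu> cZ cards that XY in auto)
  have "\<exists>u0\<in>verts G. nbrs G u0 \<noteq> ?N u0"
  proof (rule ccontr)
    assume "\<not> ?thesis"
    then have full: "nbrs G u = ?N u" if "u \<in> verts G" for u using that by blast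
    let ?H = "delete_edges_of (complete_bipartite m m) (complete_bipartite 1 (m - k + 1))"
    have vH: "verts ?H = verts (complete_bipartite m m)" by (simp add: delete_edges_of_def)
    have "graph_isomorphic G ?H"
    proof (rule star_deleted_graphs_isomorphic[OF fin _ _ XY x0(1) ZY full, of "Inl ` {..<m}" "Inr ` {..<m}"])
      show "verts ?H = Inl ` {..<m} \<union> Inr ` {..<m}" unfolding vH by (auto simp: complete_bipartite_def)
      show "nbrs ?H u = star_deleted_nbrs (Inl ` {..<m}) (Inr ` {..<m}) (Inl 0) (Inr ` {..<m - k + 1}) u"
        if "u \<in> verts ?H" for u
        by (rule nbrs_complete_bipartite_minus_star) (use k that vH in auto)
      show "card Z = card (Inr ` {..<m - k + 1} :: (nat + nat) set)" using Z(2) by (simp add: card_image)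
      show "(Inr ` {..<m - k + 1} :: (nat + nat) set) \<subseteq> Inr ` {..<m}" using k by auto
      show "Inl 0 \<in> (Inl ` {..<m} :: (nat + nat) set)" using k by auto
    qed (use cards in \<open>auto simp: card_image\<close>)
    then show False using not_iso by blast
  qed
  then obtain u0 where u0: "u0 \<in> verts G" "nbrs G u0 \<noteq> ?N u0" by blast
  obtain f where f: "graph_eigenfunction G (graph_spectral_radius G) f"
    using graph_spectral_radius_eigenfunction[OF finV] conn by (auto simp: connected_graph_def)
  show ?thesis
  proof (rule eigenvalue_less_of_supersolution[OF conn sg f wpos _ u0(1)])
    fix u assume u: "u \<in> verts G"
    show "sum w (nbrs G u) \<le> \<mu> * w u"
      unfolding wN[OF u, symmetric] by (rule sum_mono2[OF finN sub[OF u]]) (use wpos in \<open>simp add: less_imp_le\<close>)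
  next
    \<comment> \<open>A neighbour missing in \<open>G\<close> carries positive weight, which makes
      the inequality at \<open>u0\<close> strict.\<close>
    obtain v where v: "v \<in> ?N u0 - nbrs G u0" using u0 sub by blast
    show "sum w (nbrs G u0) < \<mu> * w u0"
      unfolding wN[OF u0(1), symmetric]
      by (rule sum_strict_mono2[OF finN sub[OF u0(1)] v]) (use wpos in \<open>auto simp: less_imp_le\<close>)
  qed
qed

text \<open>If \<open>S = X\<close>, the rectangle contains every edge at \<open>T\<close>, so the
  average degree on \<open>T\<close> is below \<open>k\<close>; \<open>T = Y\<close> is symmetric.
  Otherwise the pairs of \<open>S \<times> T\<close> that are not edges already number at least
  \<open>m\<close>.\<close>

lemma cut_violation_low_degree_or_few_edges:
  assumes fin: "finite X" "finite Y" and cards: "card X = m" "card Y = m"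
    and E: "E \<subseteq> X \<times> Y" and k: "k < m" and viol: "\<not> cut_condition X Y k E"
  shows "(\<exists>x\<in>X. card (E `` {x}) < k) \<or> (\<exists>y\<in>Y. card (E\<inverse> `` {y}) < k) \<or> card E + m \<le> m * m"
proof -
  obtain S T where ST: "S \<subseteq> X" "T \<subseteq> Y"
    and less: "int (card (E \<inter> S \<times> T)) < int k * (int (card S) + int (card T) - int m)"
    using viol cards by (auto simp: cut_condition_def not_le)
  have fST: "finite S" "finite T" using ST fin finite_subset by blast+
  have finE: "finite E" using E fin by (meson finite_SigmaI finite_subset)
  consider "S = X" | "T = Y" | "S \<noteq> X" "T \<noteq> Y" by blast
  then show ?thesis
  proof cases
    case 1
    have "\<exists>y\<in>T. card (E\<inverse> `` {y}) < k"
    proof (rule ccontr)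
      assume "\<not> ?thesis"
      then have ge: "\<And>y. y \<in> T \<Longrightarrow> k \<le> card (E\<inverse> `` {y})" by (meson not_le)
      have "card (E \<inter> S \<times> T) = (\<Sum>y\<in>T. card ((E \<inter> S \<times> T)\<inverse> `` {y}))"
        by (rule card_rel_eq_sum_columns[OF fST]) auto
      also have "\<dots> = (\<Sum>y\<in>T. card (E\<inverse> `` {y}))"
        by (intro sum.cong refl arg_cong[where f = card]) (use E 1 in auto)
      also have "\<dots> \<ge> (\<Sum>y\<in>T. k)" by (rule sum_mono[OF ge])
      finally have "card T * k \<le> card (E \<inter> S \<times> T)" by simp
      then have "int (card T * k) \<le> int (card (E \<inter> S \<times> T))" by linarith
      then show False using less 1 cards by (simp add: mult.commute)
    qed
    then show ?thesis using ST by blast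
  next
    case 2
    have "\<exists>x\<in>S. card (E `` {x}) < k"
    proof (rule ccontr)
      assume "\<not> ?thesis"
      then have ge: "\<And>x. x \<in> S \<Longrightarrow> k \<le> card (E `` {x})" by (meson not_le)
      have "card (E \<inter> S \<times> T) = (\<Sum>x\<in>S. card ((E \<inter> S \<times> T) `` {x}))"
        by (rule card_rel_eq_sum_rows[OF fST]) auto
      also have "\<dots> = (\<Sum>x\<in>S. card (E `` {x}))"
        by (intro sum.cong refl arg_cong[where f = card]) (use E 2 in auto)
      also have "\<dots> \<ge> (\<Sum>x\<in>S. k)" by (rule sum_mono[OF ge])
      finally have "card S * k \<le> card (E \<inter> S \<times> T)" by simp
      then have "int (card S * k) \<le> int (card (E \<inter> S \<times> T))" by linarith
      then show False using less 2 cards by (simp add: mult.commute)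
    qed
    then show ?thesis using ST by blast
  next
    case 3
    have sm: "card S < m" "card T < m" 
      using 3 ST psubset_card_mono[OF fin(1), of S] psubset_card_mono[OF fin(2), of T] cards by auto
    have "E \<subseteq> (X \<times> Y - S \<times> T) \<union> (E \<inter> S \<times> T)" using E by auto
    then have "card E \<le> card ((X \<times> Y - S \<times> T) \<union> (E \<inter> S \<times> T))"
      using fin finE by (intro card_mono) auto
    also have "\<dots> \<le> card (X \<times> Y - S \<times> T) + card (E \<inter> S \<times> T)" by (rule card_Un_le)
    also have "card (X \<times> Y - S \<times> T) = m * m - card S * card T"
      using ST fST cards by (subst card_Diff_subset) (auto simp: card_cartesian_product)
    finally have cE: "card E \<le> m * m - card S * card T + card (E \<inter> S \<times> T)" .
    have "card S * card T \<le> m * m" using sm by (intro mult_mono) auto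
    then have cE': "int (card E) \<le> int m * int m - int (card S) * int (card T) + int (card (E \<inter> S \<times> T))"
      using cE by (metis (mono_tags) of_nat_add of_nat_diff of_nat_le_iff of_nat_mult)
    \<comment> \<open>\<open>\<alpha>\<close> and \<open>\<beta>\<close> count the vertices outside
      \<open>S\<close> and \<open>T\<close>, both at least one here; the violation becomes
      \<open>e < int k * \<gamma>\<close> with \<open>\<gamma>\<close> defined next.\<close>
    define \<alpha> \<beta> e where "\<alpha> = int m - int (card S)" and "\<beta> = int m - int (card T)" and "e = int (card (E \<inter> S \<times> T))"
    define \<gamma> where "\<gamma> = int m - \<alpha> - \<beta>"
    have ab: "\<alpha> \<ge> 1" "\<beta> \<ge> 1" using sm by (auto simp: \<alpha>_def \<beta>_def)
    have "int (card S) + int (card T) - int m = \<gamma>" by (simp add: \<gamma>_def \<alpha>_def \<beta>_def)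
    then have e: "e < int k * \<gamma>" "0 \<le> e" using less by (auto simp: e_def)
    have \<gamma>: "\<gamma> \<ge> 1"
    proof (rule ccontr)
      assume "\<not> ?thesis"
      then have "int k * \<gamma> \<le> 0" by (intro mult_nonneg_nonpos) auto
      then show False using e by linarith
    qed
    have st: "int (card S) * int (card T) = int m * \<gamma> + \<alpha> * \<beta>"
      by (simp add: \<gamma>_def \<alpha>_def \<beta>_def algebra_simps)
    \<comment> \<open>Expanding gives
      \<open>\<alpha> * \<beta> \<ge> \<alpha> + \<beta> - 1\<close>, and \<open>k < m\<close>
      contributes another \<open>\<gamma>\<close>; the missing one comes from the strictness of
      \<open>e < int k * \<gamma>\<close>.\<close>
    have "0 \<le> (\<alpha> - 1) * (\<beta> - 1)" using ab by simp
    then have "\<alpha> * \<beta> \<ge> int m - \<gamma> - 1" by (simp add: \<gamma>_def algebra_simps)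
    moreover have "1 * \<gamma> \<le> (int m - int k) * \<gamma>" using k \<gamma> by (intro mult_right_mono) auto
    ultimately have "int m * \<gamma> + \<alpha> * \<beta> - int k * \<gamma> + 1 \<ge> int m"
      by (simp add: algebra_simps)
    then have "int (card E) + int m \<le> int m * int m" using cE' e st by (simp add: e_def)
    then have "card E + m \<le> m * m" by (metis of_nat_add of_nat_le_iff of_nat_mult)
    then show ?thesis by simp
  qed
qed

text \<open>The weights form an eigenfunction of the concrete graph, and every eigenvalue is at most
  the maximum; this turns the hypothesis on \<open>G\<close> into a lower bound by
  \<open>\<mu>\<close>.\<close>

lemma star_deleted_spectral_radius_ge:
  fixes \<mu> a b c d :: real
  assumes k: "2 \<le> k" "k \<le> m - 1" and a: "a > 0"
    and \<mu>: "\<mu> * a = real (k - 1) * d" "\<mu> * b = (real m - real (k - 1)) * c + real (k - 1) * d"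
      "\<mu> * c = (real m - 1) * b" "\<mu> * d = a + (real m - 1) * b"
  shows "\<mu> \<le> graph_spectral_radius
    (delete_edges_of (complete_bipartite m m) (complete_bipartite 1 (m - k + 1)))"
proof -
  let ?H = "delete_edges_of (complete_bipartite m m) (complete_bipartite 1 (m - k + 1))"
  let ?X = "Inl ` {..<m} :: (nat + nat) set" and ?Y = "Inr ` {..<m} :: (nat + nat) set"
  let ?Z = "Inr ` {..<m - k + 1} :: (nat + nat) set"
  define w where "w = (\<lambda>u. if u = Inl 0 then a else if u \<in> ?X then b else if u \<in> ?Z then c else d)"
  have V: "verts ?H = ?X \<union> ?Y" "verts ?H = verts (complete_bipartite m m)"
    by (auto simp: delete_edges_of_def complete_bipartite_def)
  have cZ: "real (card ?Z) = real m - real (k - 1)" using k by (simp add: card_image of_nat_diff)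
  have cXY: "card ?X = m" "card ?Y = m" by (simp_all add: card_image)
  have wN: "sum w (nbrs ?H u) = \<mu> * w u" if u: "u \<in> verts ?H" for u
  proof -
    have "nbrs ?H u = star_deleted_nbrs ?X ?Y (Inl 0) ?Z u"
      by (rule nbrs_complete_bipartite_minus_star) (use k u V in auto)
    moreover have "sum w (star_deleted_nbrs ?X ?Y (Inl 0) ?Z u) = \<mu> * w u"
      by (rule sum_weights_star_deleted_nbrs[OF _ _ _ _ _ _ _ _ _ _ w_def])
        (use \<mu> u V k in \<open>auto simp only: cZ cXY, auto\<close>)
    ultimately show ?thesis by simp
  qed
  have "Inl 0 \<in> verts ?H" using V(1) k by auto
  moreover have "w (Inl 0) \<noteq> 0" using a by (simp add: w_def)
  ultimately have "graph_eigenfunction ?H \<mu> w" using wN by (auto simp: graph_eigenfunction_def)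
  then show ?thesis by (rule graph_spectral_radius_ge[rotated]) (simp only: V(1), simp)
qed

section \<open>Contradiction from a violated cut condition\<close>

theorem corollary1p4:
  fixes G :: "'a ugraph" and n k :: nat
  assumes "even n" and "n > 0"
    and "2 \<le> k" and "k \<le> n div 2 - 1"
    and "simple_graph G" and "connected_graph G" and "balanced_bipartite G"
    and "card (verts G) = n"
    and "graph_spectral_radius G \<ge>
      graph_spectral_radius
        (delete_edges_of (complete_bipartite (n div 2) (n div 2))
          (complete_bipartite 1 (n div 2 - k + 1)))"
    and "\<not> graph_isomorphic G
      (delete_edges_of (complete_bipartite (n div 2) (n div 2))
        (complete_bipartite 1 (n div 2 - k + 1)))"
  shows "has_edge_disjoint_perfect_matchings G k"
proof (rule ccontr)
  assume no: "\<not> has_edge_disjoint_perfect_matchings G k"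
  define m where "m = n div 2"
  have k: "2 \<le> k" "k \<le> m - 1" using assms(3,4) by (auto simp: m_def)
  obtain X Y where bip: "bipartition G X Y" and eqc: "card X = card Y"
    using assms(7) by (auto simp: balanced_bipartite_def)
  have XY: "X \<union> Y = verts G" "X \<inter> Y = {}" using bip by (auto simp: bipartition_def)
  have finV: "finite (verts G)" using assms(5) by (simp add: simple_graph_def)
  then have fin: "finite X" "finite Y" unfolding XY(1)[symmetric] by auto
  have "card X + card Y = n" using card_Un_disjoint[OF fin XY(2)] XY(1) assms(8) by simp
  then have cards: "card X = m" "card Y = m" using eqc by (auto simp: m_def)
  have viol: "\<not> cut_condition X Y k (bip_rel G X Y)"
    using cut_condition_imp_edge_disjoint_perfect_matchings[OF fin eqc bip] no by blast
  \<comment> \<open>\<open>q = k - 1\<close> is the degree left at the centre after deleting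
    \<open>m - k + 1\<close> of its \<open>m\<close> edges.\<close>
  have real_k: "1 \<le> real (k - 1)" "real (k - 1) < real m" "2 \<le> real m" using k by auto
  obtain \<mu> a b c d where pos: "\<mu> > 0" "a > 0" "b > 0" "c > 0" "d > 0"
    and big: "real m * (real m - 1) < \<mu>\<^sup>2"
    and \<mu>: "\<mu> * a = real (k - 1) * d" "\<mu> * b = (real m - real (k - 1)) * c + real (k - 1) * d"
      "\<mu> * c = (real m - 1) * b" "\<mu> * d = a + (real m - 1) * b"
    using perron_weights[OF real_k] by metis
  let ?r = "graph_spectral_radius G"
  have \<mu>_le: "\<mu> \<le> ?r"
    using star_deleted_spectral_radius_ge[OF k pos(2) \<mu>] assms(9) unfolding m_def by linarith
  \<comment> \<open>The bipartition is left open, so that the bound serves a low-degree vertex in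
    either part.\<close>
  note low = low_degree_spectral_radius_less[OF assms(5,6) _ _ _ k _ _ assms(10)[folded m_def] pos(2-5) \<mu>]
  have bip': "bipartition G Y X"
    using bip unfolding bipartition_def by (metis Int_commute Un_commute insert_commute)
  have "bip_rel G X Y \<subseteq> X \<times> Y" by (auto simp: bip_rel_def)
  moreover have "k < m" using k by linarith
  ultimately consider (x) x where "x \<in> X" "card (bip_rel G X Y `` {x}) < k"
    | (y) y where "y \<in> Y" "card ((bip_rel G X Y)\<inverse> `` {y}) < k"
    | (few) "card (bip_rel G X Y) + m \<le> m * m"
    using cut_violation_low_degree_or_few_edges[OF fin cards _ _ viol] by blast
  then show False
  proof cases
    case (x x)
    then have "?r < \<mu>" using low[OF bip cards x(1)] bipartition_nbrs(1)[OF bip] by simp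
    then show False using \<mu>_le by simp
  next
    case (y y)
    then have "?r < \<mu>" using low[OF bip' cards(2,1) y(1)] bipartition_nbrs(2)[OF bip] by simp
    then show False using \<mu>_le by simp
  next
    case few
    obtain f where f: "graph_eigenfunction G ?r f"
      using graph_spectral_radius_eigenfunction[OF finV] assms(6) by (auto simp: connected_graph_def)
    have "real (card (bip_rel G X Y) + m) \<le> real (m * m)" using few by (simp only: of_nat_le_iff)
    then have "?r\<^sup>2 \<le> real m * (real m - 1)"
      using bipartite_eigenvalue_square_le[OF fin bip f] by (simp add: algebra_simps)
    moreover have "\<mu>\<^sup>2 \<le> ?r\<^sup>2" using \<mu>_le pos(1) by (intro power_mono) auto
    ultimately show False using big by linarith
  qed
qed

end
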